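(* For every finite acyclic graph (forest) $G$ with at least one edge, $\gamma(G)\le \mathrm{rad}(G)$.
   Context: All graphs are finite, simple and undirected. A graph $G=(V,E)$ is a star-$k$-PCG if there exist a weight function $w:V\to\mathbb{R}^+$ and $k$ pairwise disjoint intervals $I_1,\dots,I_k$ such that for distinct $u,v\in V$, $uv\in E$ if and only if $w(u)+w(v)\in\bigcup_i I_i$. The star number $\gamma(G)$ is the least positive integer $k$ such that $G$ is a star-$k$-PCG. For a connected graph, the eccentricity of a vertex is its maximum distance to any other vertex and the radius is the minimum eccentricity; for a disconnected graph $G$, $\mathrm{rad}(G)$ is the maximum of the radii of its connected components. *)

theory Defs
  imports "HOL-Analysis.Analysis" "Graph_Theory.Graph_Theory"
begin

text \<open>
  A finite simple undirected graph is a \<^term>\<open>graph G\<close> of the library: a finite symmetric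
  digraph without loops and parallel arcs, each edge being a pair of opposite arcs.
\<close>

text \<open>
  The library's \<^const>\<open>forest\<close> is about directed cycles and fails for every symmetric digraph
  with an arc, because traversing an edge back and forth is a directed cycle of length 2.
  In a loop-free symmetric digraph without parallel arcs, the directed cycles of length at
  least 3 are exactly the cycles of the undirected graph.
\<close>

definition acyclic_graph :: "('a, 'b) pre_digraph \<Rightarrow> bool" where
  "acyclic_graph G \<longleftrightarrow> \<not> (\<exists>p. pre_digraph.cycle G p \<and> 3 \<le> length p)"

definition is_star_k_PCG :: "nat \<Rightarrow> ('a, 'b) pre_digraph \<Rightarrow> bool" where
  "is_star_k_PCG k G \<longleftrightarrow>
    (\<exists>(w :: 'a \<Rightarrow> real) (I :: nat \<Rightarrow> real set).
       (\<forall>v \<in> verts G. 0 < w v) \<and>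
       (\<forall>i \<in> {1..k}. is_interval (I i) \<and> I i \<noteq> {}) \<and>
       disjoint_family_on I {1..k} \<and>
       (\<forall>u \<in> verts G. \<forall>v \<in> verts G. u \<noteq> v \<longrightarrow>
          (u \<rightarrow>\<^bsub>G\<^esub> v \<longleftrightarrow> w u + w v \<in> (\<Union>i \<in> {1..k}. I i))))"

definition star_number :: "('a, 'b) pre_digraph \<Rightarrow> nat" where
  "star_number G = (LEAST k. 0 < k \<and> is_star_k_PCG k G)"

text \<open>Meaningful only if \<open>v\<close> is reachable from \<open>u\<close>; below it is used inside components.\<close>

definition graph_dist :: "('a, 'b) pre_digraph \<Rightarrow> 'a \<Rightarrow> 'a \<Rightarrow> nat" where
  "graph_dist G u v = (LEAST n. \<exists>p. pre_digraph.awalk G u p v \<and> length p = n)"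

text \<open>
  The vertex itself contributes only the distance 0, so including it changes nothing except
  that the eccentricity in a one-vertex graph is 0.
\<close>

definition eccentricity :: "('a, 'b) pre_digraph \<Rightarrow> 'a \<Rightarrow> nat" where
  "eccentricity G u = Max (graph_dist G u ` verts G)"

definition connected_radius :: "('a, 'b) pre_digraph \<Rightarrow> nat" where
  "connected_radius G = Min (eccentricity G ` verts G)"

text \<open>
  In a symmetric digraph the strongly connected components are the connected components;
  if \<open>G\<close> is connected, \<open>G\<close> itself is the only one.
\<close>

definition rad :: "('a, 'b) pre_digraph \<Rightarrow> nat" where
  "rad G = Max (connected_radius ` pre_digraph.sccs G)"

end

theory Submission
  imports Defs
begin

text \<open>
  Root every component at a vertex of minimum eccentricity, so that all levels are at most
  \<open>r = rad G\<close>. Acyclicity makes every edge join a vertex to its unique parent on the previous level.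
  A vertex of level \<open>k\<close> gets the weight \<open>L * 2 ^ k\<close> plus a bounded offset. Since
  \<open>2 ^ i + 2 ^ j = 2 ^ (k - 1) + 2 ^ k\<close> forces \<open>{i, j} = {k - 1, k}\<close>, one short interval around
  \<open>L * (2 ^ (k - 1) + 2 ^ k)\<close> for each \<open>k = 1, \<dots>, r\<close> only sees pairs of consecutive levels.
  The offset of a vertex is minus that of its parent plus a perturbation at the scale \<open>\<delta> ^ k\<close>
  that separates siblings. Offsets within level \<open>k - 1\<close> differ by at least \<open>\<delta> ^ (k - 1)\<close>, so only
  the sum with the parent's weight comes close to the centre of the interval.
\<close>

section \<open>Weights from levels and parents\<close>

text \<open>Induction on \<open>k\<close> by halving. For \<open>k = 0\<close> the sum is 3, and
  parity makes one exponent 0 and the other 1. For larger \<open>k\<close> the right side is even,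
  so one zero exponent would force both to be 0 and the sum to be only 2; otherwise both sides can
  be divided by 2.\<close>

lemma pow2_add_eq_consecutive:
  assumes "2 ^ i + 2 ^ j = 2 ^ k + (2 :: nat) ^ Suc k"
  shows "(i = k \<and> j = Suc k) \<or> (i = Suc k \<and> j = k)"
  using assms
proof (induction k arbitrary: i j)
  case 0
  show ?case
  proof (cases i)
    case 0
    then have "(2::nat) ^ j = 2 ^ 1" using "0.prems" by simp
    then have "j = 1" by (simp only: power_inject_exp)
    then show ?thesis using 0 by simp
  next
    case (Suc i')
    have "odd ((2::nat) ^ i + 2 ^ j)" unfolding "0.prems" by simp
    then have "odd ((2::nat) ^ j)" using Suc by simp
    then have "j = 0" by auto
    then have "(2::nat) ^ i = 2 ^ 1" using "0.prems" by simp
    then have "i = 1" by (simp only: power_inject_exp)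
    then show ?thesis using \<open>j = 0\<close> by simp
  qed
next
  case (Suc k)
  show ?case
  proof (cases "i = 0 \<or> j = 0")
    case True
    have e: "even ((2::nat) ^ i + 2 ^ j)" unfolding Suc.prems by simp
    then have "i = 0 \<and> j = 0" using True by auto
    then have "2 ^ Suc k + 2 ^ Suc (Suc k) = (2::nat)"
      using Suc.prems by (metis power_0 one_add_one)
    moreover have "(2::nat) ^ k > 0" by simp
    ultimately have False unfolding power_Suc by linarith
    then show ?thesis ..
  next
    case False
    then obtain i' j' where "i = Suc i'" "j = Suc j'" by (meson nat.exhaust)
    then show ?thesis using Suc.IH[of i' j'] Suc.prems by simp
  qed
qed

text \<open>Unrolled, this is the alternating sum of the labels \<open>n\<close> along the chain of
  parents of \<open>v\<close>, scaled by descending powers of \<open>\<delta>\<close>. The level is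
  an explicit argument to make the recursion primitive; it is later instantiated with
  \<open>d v\<close>.\<close>

primrec level_offset :: "('a \<Rightarrow> 'a) \<Rightarrow> ('a \<Rightarrow> nat) \<Rightarrow> real \<Rightarrow> nat \<Rightarrow> 'a \<Rightarrow> real" where
  "level_offset par n \<delta> 0 v = real (n v)"
| "level_offset par n \<delta> (Suc k) v = real (n v) * \<delta> ^ Suc k - level_offset par n \<delta> k (par v)"

lemma abs_level_offset_le:
  assumes "\<And>v. n v \<le> N" and "0 \<le> \<delta>" "\<delta> \<le> 1"
  shows "\<bar>level_offset par n \<delta> k v\<bar> \<le> (real k + 1) * real N"
proof (induction k arbitrary: v)
  case 0
  then show ?case using assms(1) by simp
next
  case (Suc k)
  have "real (n v) * \<delta> ^ Suc k \<le> real N * 1"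
    by (intro mult_mono power_le_one) (use assms in auto)
  moreover have "0 \<le> real (n v) * \<delta> ^ Suc k" using assms by simp
  ultimately show ?case using Suc[of "par v"]
    by (simp add: algebra_simps del: power_Suc)
qed

text \<open>Siblings inherit the same term, so their distinct labels alone separate them. For
  different parents the induction hypothesis gives a gap of \<open>\<delta> ^ k\<close>; the
  perturbations consume at most \<open>N * \<delta> ^ Suc k\<close> of it, and
  \<open>\<delta> * (N + 1) \<le> 1\<close> leaves \<open>\<delta> ^ Suc k\<close>.\<close>

lemma level_offset_gap:
  fixes par :: "'a \<Rightarrow> 'a" and d n :: "'a \<Rightarrow> nat"
  assumes le: "\<And>v. n v \<le> N" and inj: "inj_on n V"
    and \<delta>: "0 < \<delta>" "\<delta> * (real N + 1) \<le> 1"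
    and par: "\<And>v. v \<in> V \<Longrightarrow> 0 < d v \<Longrightarrow> par v \<in> V \<and> d v = Suc (d (par v))"
    and uv: "u \<in> V" "v \<in> V" "u \<noteq> v" "d u = k" "d v = k"
  shows "\<delta> ^ k \<le> \<bar>level_offset par n \<delta> k u - level_offset par n \<delta> k v\<bar>"
  using uv
proof (induction k arbitrary: u v)
  case 0
  then have "n u \<noteq> n v" using inj by (auto dest: inj_onD)
  then show ?case by simp
next
  case (Suc k)
  let ?x = "level_offset par n \<delta> k"
  have ne: "n u \<noteq> n v" using Suc.prems inj by (auto dest: inj_onD)
  have pos: "0 < \<delta> ^ Suc k" using \<delta> by simp
  have dec: "level_offset par n \<delta> (Suc k) u - level_offset par n \<delta> (Suc k) v
      = (real (n u) - real (n v)) * \<delta> ^ Suc k - (?x (par u) - ?x (par v))"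
    by (simp add: algebra_simps)
  show ?case
  proof (cases "par u = par v")
    case True
    have "1 * \<delta> ^ Suc k \<le> \<bar>real (n u) - real (n v)\<bar> * \<delta> ^ Suc k"
      by (intro mult_right_mono) (use ne pos in auto)
    then show ?thesis unfolding dec using True pos by (simp add: abs_mult del: power_Suc)
  next
    case False
    have "\<delta> ^ k \<le> \<bar>?x (par u) - ?x (par v)\<bar>"
      using par[of u] par[of v] Suc.prems False by (intro Suc.IH) auto
    moreover have "\<bar>(real (n u) - real (n v)) * \<delta> ^ Suc k\<bar> \<le> real N * \<delta> ^ Suc k"
      unfolding abs_mult using le[of u] le[of v] pos
      by (intro mult_mono) auto
    moreover have "(real N + 1) * \<delta> ^ Suc k \<le> \<delta> ^ k"
    proof -
      have "(real N + 1) * \<delta> ^ Suc k = \<delta> ^ k * (\<delta> * (real N + 1))" by simp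
      also have "\<dots> \<le> \<delta> ^ k * 1" by (intro mult_left_mono) (use \<delta> in auto)
      finally show ?thesis by simp
    qed
    ultimately show ?thesis unfolding dec
      by (simp add: distrib_right del: power_Suc)
  qed
qed

section \<open>Assembling weights and intervals\<close>

lemma star_PCG_of_levels:
  fixes G :: "('a, 'b) pre_digraph" and d :: "'a \<Rightarrow> nat" and par :: "'a \<Rightarrow> 'a"
  assumes fin: "finite (verts G)"
    and depth: "\<And>v. v \<in> verts G \<Longrightarrow> d v \<le> r"
    and par: "\<And>v. v \<in> verts G \<Longrightarrow> 0 < d v \<Longrightarrow> par v \<in> verts G \<and> d v = Suc (d (par v))"
    and adj: "\<And>u v. u \<in> verts G \<Longrightarrow> v \<in> verts G \<Longrightarrow>
      u \<rightarrow>\<^bsub>G\<^esub> v \<longleftrightarrow> (0 < d v \<and> u = par v) \<or> (0 < d u \<and> v = par u)"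
  shows "is_star_k_PCG r G"
proof -
  obtain n0 :: "'a \<Rightarrow> nat" and m where n0: "n0 ` verts G = {i. i < m}" "inj_on n0 (verts G)"
    using finite_imp_inj_to_nat_seg[OF fin] by blast
  \<comment> \<open>The successor keeps \<open>N\<close> positive even without vertices. Labels are
    extended by 0 so that the bound \<open>N\<close> holds on the whole type, as the offset lemmas
    demand.\<close>
  define N where "N = Suc m"
  define n where "n v = (if v \<in> verts G then n0 v else 0)" for v
  have n_le: "n v \<le> N" for v
  proof (cases "v \<in> verts G")
    case True
    then have "n0 v \<in> {i. i < m}" unfolding n0(1)[symmetric] by simp
    then show ?thesis by (simp add: n_def N_def)
  qed (simp add: n_def)
  have n_inj: "inj_on n (verts G)"
    using n0(2) by (auto simp: n_def inj_on_def)
  \<comment> \<open>Small enough both for the gap lemma, by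
    \<open>\<delta> * (N + 1) \<le> 1\<close>, and to make an interval narrower than the gap on the
    parents' level, by \<open>2 * N * \<delta> < 1\<close>.\<close>
  define \<delta> where "\<delta> = 1 / (2 * real N + 1)"
  have \<delta>: "0 < \<delta>" "\<delta> \<le> 1" "\<delta> * (real N + 1) \<le> 1" "2 * real N * \<delta> < 1"
    by (auto simp: \<delta>_def field_simps)
  define x where "x v = level_offset par n \<delta> (d v) v" for v
  define B where "B = (real r + 1) * real N"
  have "0 < real N" by (simp add: N_def)
  have "real N \<le> B" by (simp add: B_def algebra_simps)
  have x_bound: "\<bar>x v\<bar> \<le> B" if "v \<in> verts G" for v
  proof -
    have "\<bar>x v\<bar> \<le> (real (d v) + 1) * real N"
      unfolding x_def using \<delta> n_le by (intro abs_level_offset_le) auto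
    also have "\<dots> \<le> B" unfolding B_def using depth[OF that] by (intro mult_right_mono) auto
    finally show ?thesis .
  qed
  \<comment> \<open>The tightest demand comes from \<open>levels\<close>: an interval radius of at
    most \<open>N \<le> B\<close> and two offsets of at most \<open>B\<close> add up to
    \<open>3 * B\<close>, which must stay below \<open>L\<close>.\<close>
  define L where "L = 4 * B"
  have "0 < L" using \<open>0 < real N\<close> \<open>real N \<le> B\<close> by (simp add: L_def)
  define w where "w v = L * 2 ^ d v + x v" for v
  define S where "S k = L * (2 ^ (k - 1) + 2 ^ k)" for k :: nat
  \<comment> \<open>The radius is the largest perturbation that a child on level \<open>k\<close>
    can receive.\<close>
  define I where "I k = {S k - real N * \<delta> ^ k .. S k + real N * \<delta> ^ k}" for k :: nat
  have I_iff: "z \<in> I k \<longleftrightarrow> \<bar>z - S k\<bar> \<le> real N * \<delta> ^ k" for z k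
    by (auto simp: I_def)
  have radius_le: "real N * \<delta> ^ k \<le> real N" for k
    using \<delta> by (simp add: mult_left_le power_le_one)
  have radius_nonneg: "0 \<le> real N * \<delta> ^ k" for k
    using \<delta> by simp
  \<comment> \<open>Distinct integer multiples of \<open>L\<close> are too far apart to be confused by offsets.\<close>
  have int_sep: "a = b" if "\<bar>L * real a - L * real b\<bar> < L" for a b :: nat
  proof -
    have "L * \<bar>real a - real b\<bar> < L * 1"
      using that \<open>0 < L\<close> by (metis abs_mult abs_of_pos mult.right_neutral right_diff_distrib)
    then have "\<bar>real a - real b\<bar> < 1" using \<open>0 < L\<close> by (simp only: mult_less_cancel_left_pos)
    then show ?thesis by linarith
  qed
  have S_nat: "S k = L * real (2 ^ (k - 1) + 2 ^ k)" for k by (simp add: S_def)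

  have w_pos: "0 < w v" if "v \<in> verts G" for v
  proof -
    have "L * 1 \<le> L * 2 ^ d v" using \<open>0 < L\<close> by (intro mult_left_mono) auto
    moreover have "B < L" using \<open>0 < real N\<close> \<open>real N \<le> B\<close> by (simp add: L_def)
    ultimately show ?thesis using x_bound[OF that] by (simp add: w_def)
  qed
  have disj: "disjoint_family_on I {1..r}"
    unfolding disjoint_family_on_def
  proof (intro ballI impI)
    fix k l assume kl: "k \<in> {1..r}" "l \<in> {1..r}" "k \<noteq> l"
    show "I k \<inter> I l = {}"
    proof (rule ccontr)
      assume "I k \<inter> I l \<noteq> {}"
      then obtain z where "z \<in> I k" "z \<in> I l" by blast
      then have "\<bar>S k - S l\<bar> \<le> 2 * real N"
        using radius_le[of k] radius_le[of l] unfolding I_iff by linarith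
      also have "\<dots> < L" using \<open>0 < real N\<close> \<open>real N \<le> B\<close> by (simp add: L_def)
      finally have "2 ^ (k - 1) + 2 ^ k = 2 ^ (l - 1) + (2::nat) ^ l"
        unfolding S_nat by (rule int_sep)
      moreover obtain k' l' where "k = Suc k'" "l = Suc l'"
        using kl by (metis atLeastAtMost_iff not0_implies_Suc not_one_le_zero)
      ultimately show False using pow2_add_eq_consecutive[of k' "Suc k'" l'] kl(3) by auto
    qed
  qed

  have child: "w u + w v \<in> I (Suc (d u)) \<longleftrightarrow> u = par v"
    if uv: "u \<in> verts G" "v \<in> verts G" "d v = Suc (d u)" for u v
  proof -
    let ?k = "d u"
    let ?p = "par v"
    have p: "?p \<in> verts G" "d ?p = ?k" using par[OF uv(2)] uv(3) by auto
    have xv: "x v = real (n v) * \<delta> ^ Suc ?k - x ?p"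
      using p by (simp add: x_def uv(3))
    \<comment> \<open>The negated parent offset inside \<open>x v\<close> cancels \<open>x u\<close>
      exactly when \<open>u\<close> is the parent, leaving only the perturbation of
      \<open>v\<close>.\<close>
    have sum: "w u + w v - S (Suc ?k) = real (n v) * \<delta> ^ Suc ?k + (x u - x ?p)"
      by (simp add: w_def S_def xv uv(3) algebra_simps del: power_Suc)
    have nv: "0 \<le> real (n v) * \<delta> ^ Suc ?k" "real (n v) * \<delta> ^ Suc ?k \<le> real N * \<delta> ^ Suc ?k"
      using \<delta> n_le[of v] by (auto intro!: mult_right_mono)
    show ?thesis
    proof
      assume "u = par v"
      then show "w u + w v \<in> I (Suc ?k)" using sum nv unfolding I_iff by simp
    next
      assume "w u + w v \<in> I (Suc ?k)"
      then have up: "\<bar>x u - x ?p\<bar> \<le> 2 * (real N * \<delta> ^ Suc ?k)"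
        using sum nv unfolding I_iff by linarith
      \<comment> \<open>The width of the interval is below the minimal gap
        \<open>\<delta> ^ ?k\<close> between offsets on the level of \<open>u\<close>, so at most
        one vertex there can match.\<close>
      have "2 * (real N * \<delta> ^ Suc ?k) = \<delta> ^ ?k * (2 * real N * \<delta>)" by simp
      also have "\<dots> < \<delta> ^ ?k * 1" by (intro mult_strict_left_mono) (use \<delta> in auto)
      finally have lt: "\<bar>x u - x ?p\<bar> < \<delta> ^ ?k" using up by simp
      show "u = par v"
      proof (rule ccontr)
        assume "u \<noteq> par v"
        then have "\<delta> ^ ?k \<le> \<bar>x u - x ?p\<bar>"
          using level_offset_gap[of n N "verts G" \<delta> d par u ?p ?k] n_le n_inj \<delta> par uv p
          by (simp add: x_def)
        then show False using lt by simp
      qed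
    qed
  qed

  have levels: "(d u = k - 1 \<and> d v = k) \<or> (d u = k \<and> d v = k - 1)"
    if uv: "u \<in> verts G" "v \<in> verts G" "k \<in> {1..r}" "w u + w v \<in> I k" for u v k
  proof -
    have *: "L * real (2 ^ d u + 2 ^ d v) - L * real (2 ^ (k - 1) + 2 ^ k)
        = (w u + w v - S k) - (x u + x v)"
      by (simp add: w_def S_def algebra_simps)
    have "\<bar>w u + w v - S k\<bar> \<le> real N"
      using uv(4) radius_le[of k] unfolding I_iff by linarith
    then have "\<bar>L * real (2 ^ d u + 2 ^ d v) - L * real (2 ^ (k - 1) + 2 ^ k)\<bar> < L"
      unfolding * using x_bound[OF uv(1)] x_bound[OF uv(2)] \<open>0 < real N\<close> \<open>real N \<le> B\<close> L_def
      by linarith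
    then have "2 ^ d u + 2 ^ d v = 2 ^ (k - 1) + (2::nat) ^ k"
      by (rule int_sep)
    moreover have "k = Suc (k - 1)" using uv(3) by simp
    ultimately show ?thesis using pow2_add_eq_consecutive[of "d u" "d v" "k - 1"] by metis
  qed

  have char: "u \<rightarrow>\<^bsub>G\<^esub> v \<longleftrightarrow> w u + w v \<in> (\<Union>i\<in>{1..r}. I i)"
    if uv: "u \<in> verts G" "v \<in> verts G" for u v
  proof
    assume "u \<rightarrow>\<^bsub>G\<^esub> v"
    then consider "0 < d v" "u = par v" | "0 < d u" "v = par u"
      unfolding adj[OF uv] by metis
    then show "w u + w v \<in> (\<Union>i\<in>{1..r}. I i)"
    proof cases
      case 1
      then have "d v = Suc (d u)" using par uv by metis
      then have "w u + w v \<in> I (d v)" "d v \<in> {1..r}"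
        using child[of u v] 1(2) uv depth[of v] by auto
      then show ?thesis by blast
    next
      case 2
      then have "d u = Suc (d v)" using par uv by metis
      then have "w u + w v \<in> I (d u)" "d u \<in> {1..r}"
        using child[of v u] 2(2) uv depth[of u] by (auto simp: add.commute)
      then show ?thesis by blast
    qed
  next
    assume "w u + w v \<in> (\<Union>i\<in>{1..r}. I i)"
    then obtain k where k: "k \<in> {1..r}" "w u + w v \<in> I k" by blast
    from levels[OF uv k] show "u \<rightarrow>\<^bsub>G\<^esub> v"
    proof
      assume *: "d u = k - 1 \<and> d v = k"
      then have "d v = Suc (d u)" using k by auto
      then show ?thesis unfolding adj[OF uv] using child[of u v] uv k(2) * by auto
    next
      assume *: "d u = k \<and> d v = k - 1"
      then have "d u = Suc (d v)" using k by auto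
      then show ?thesis
        unfolding adj[OF uv] using child[of v u] uv k(2) * by (auto simp: add.commute)
    qed
  qed

  have "is_interval (I i) \<and> I i \<noteq> {}" for i
    using radius_nonneg[of i] by (simp add: I_def is_interval_cc)
  then show ?thesis
    unfolding is_star_k_PCG_def using w_pos disj char by blast
qed

section \<open>Levels in an acyclic graph\<close>

context graph
begin

text \<open>Climb from both ends to parents until the two branches meet, at the latest in the common
  root. The level bound is carried along to keep the path simple, the length bound to make the
  cycles closed with it long enough.\<close>

lemma apath_through_lower_levels:
  fixes d :: "'a \<Rightarrow> nat"
  assumes parent: "\<And>v. v \<in> verts G \<Longrightarrow> 0 < d v \<Longrightarrow> \<exists>u. u \<rightarrow>\<^bsub>G\<^esub> v \<and> d v = Suc (d u)"
    and root: "\<And>u v. u \<rightarrow>\<^sup>*\<^bsub>G\<^esub> v \<Longrightarrow> d u = 0 \<Longrightarrow> d v = 0 \<Longrightarrow> u = v"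
    and uv: "u \<rightarrow>\<^sup>*\<^bsub>G\<^esub> v" "d u = k" "d v = k"
  shows "\<exists>p. apath u p v \<and> (\<forall>x \<in> set (awalk_verts u p). d x \<le> k) \<and> (u \<noteq> v \<longrightarrow> 2 \<le> length p)"
  using uv
proof (induction k arbitrary: u v)
  case 0
  then have "u = v" "u \<in> verts G" using root by (auto simp: reachable_in_verts)
  then show ?case using 0 by (intro exI[of _ "[]"]) (simp add: apath_Nil_iff)
next
  case (Suc k)
  have in_verts: "u \<in> verts G" "v \<in> verts G" using Suc.prems(1) by (auto simp: reachable_in_verts)
  show ?case
  proof (cases "u = v")
    case True
    then show ?thesis using Suc.prems in_verts
      by (intro exI[of _ "[]"]) (simp add: apath_Nil_iff)
  next
    case False
    obtain u' where u': "u' \<rightarrow>\<^bsub>G\<^esub> u" "d u' = k" using parent[of u] Suc.prems in_verts by auto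
    obtain v' where v': "v' \<rightarrow>\<^bsub>G\<^esub> v" "d v' = k" using parent[of v] Suc.prems in_verts by auto
    have "u' \<rightarrow>\<^sup>*\<^bsub>G\<^esub> v'"
      using u'(1) Suc.prems(1) v'(1) by (meson adj_in_verts arcs_ends_conv graph_symmetric
          reachable_adjI reachable_trans)
    then obtain p where p: "apath u' p v'" "\<forall>x \<in> set (awalk_verts u' p). d x \<le> k"
      using Suc.IH u'(2) v'(2) by blast
    obtain e where e: "e \<in> arcs G" "tail G e = u" "head G e = u'"
      using graph_symmetric[OF u'(1)] by auto
    obtain f where f: "f \<in> arcs G" "tail G f = v'" "head G f = v"
      using v'(1) by auto
    \<comment> \<open>Both ends lie one level above everything on the inner path, so attaching them
      creates no repeated vertex.\<close>
    have lv: "u \<notin> set (awalk_verts u' p)" "v \<notin> set (awalk_verts u' p)"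
      using p(2) Suc.prems by auto
    have wp: "awalk u' p v'" using p(1) by (rule awalkI_apath)
    have w: "awalk u (e # p @ [f]) v"
      using wp e f in_verts by (auto simp: awalk_Cons_iff awalk_Nil_iff)
    have vs: "awalk_verts u (e # p @ [f]) = u # awalk_verts u' p @ [v]"
      using wp w e f by (auto simp: awalk_verts_append awalk_Cons_iff)
    have "apath u (e # p @ [f]) v"
      using w p(1) lv False unfolding apath_def vs by auto
    moreover have "\<forall>x \<in> set (awalk_verts u (e # p @ [f])). d x \<le> Suc k"
      unfolding vs using p(2) Suc.prems by auto
    ultimately show ?thesis by (intro exI[of _ "e # p @ [f]"]) auto
  qed
qed

text \<open>The closing arc is put in front, so that the vertex list of the closed walk without its
  first entry is that of the path, hence distinct.\<close>

lemma cycle_of_apath: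
  assumes "apath u p v" "v \<rightarrow>\<^bsub>G\<^esub> u"
  shows "\<exists>e. cycle (e # p)"
proof -
  obtain e where e: "e \<in> arcs G" "tail G e = v" "head G e = u" using assms(2) by auto
  have "awalk v (e # p) v" using assms(1) e by (simp add: awalk_Cons_iff awalkI_apath)
  moreover have "distinct (tl (awalk_verts v (e # p)))"
    using assms(1) e by (simp add: apath_def)
  ultimately show ?thesis unfolding cycle_def by blast
qed

text \<open>An edge inside a level, or two parents of one vertex, would close a path through lower
  levels to a cycle. In the second case the cycle passes through the child, which lies above the
  whole path.\<close>

lemma acyclic_levels:
  fixes d :: "'a \<Rightarrow> nat"
  assumes acyclic: "acyclic_graph G"
    and parent: "\<And>v. v \<in> verts G \<Longrightarrow> 0 < d v \<Longrightarrow> \<exists>u. u \<rightarrow>\<^bsub>G\<^esub> v \<and> d v = Suc (d u)"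
    and root: "\<And>u v. u \<rightarrow>\<^sup>*\<^bsub>G\<^esub> v \<Longrightarrow> d u = 0 \<Longrightarrow> d v = 0 \<Longrightarrow> u = v"
  shows acyclic_levels_adj_neq: "u \<rightarrow>\<^bsub>G\<^esub> v \<Longrightarrow> d u \<noteq> d v"
    and acyclic_levels_parent_unique:
      "u \<rightarrow>\<^bsub>G\<^esub> v \<Longrightarrow> u' \<rightarrow>\<^bsub>G\<^esub> v \<Longrightarrow> d v = Suc (d u) \<Longrightarrow> d v = Suc (d u') \<Longrightarrow> u = u'"
proof -
  have no_cycle: "\<not> (cycle p \<and> 3 \<le> length p)" for p
    using acyclic by (auto simp: acyclic_graph_def)
  \<comment> \<open>Length at least 2 matters: with the closing arc the cycle has length at least 3,
    ruling out an edge merely traversed back and forth.\<close>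
  have path: "\<exists>p. apath u p v \<and> (\<forall>x \<in> set (awalk_verts u p). d x \<le> d u) \<and> (u \<noteq> v \<longrightarrow> 2 \<le> length p)"
    if "u \<rightarrow>\<^sup>*\<^bsub>G\<^esub> v" "d u = d v" for u v
    by (rule apath_through_lower_levels[OF parent root]) (assumption | simp add: that)+
  show "d u \<noteq> d v" if uv: "u \<rightarrow>\<^bsub>G\<^esub> v"
  proof
    assume eq: "d u = d v"
    have "u \<noteq> v" using uv adj_not_same by blast
    then obtain p where p: "apath u p v" "2 \<le> length p"
      using path[of u v] uv eq by blast
    then show False
      using cycle_of_apath[OF p(1) graph_symmetric[OF uv]] no_cycle[of "_ # p"] by auto
  qed
  show "u = u'" if h: "u \<rightarrow>\<^bsub>G\<^esub> v" "u' \<rightarrow>\<^bsub>G\<^esub> v" "d v = Suc (d u)" "d v = Suc (d u')"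
  proof (rule ccontr)
    assume "u \<noteq> u'"
    have "u \<rightarrow>\<^sup>*\<^bsub>G\<^esub> u'"
      using h graph_symmetric by (meson reachable_adjI reachable_trans)
    then obtain p where p: "apath u p u'" "2 \<le> length p"
        "\<forall>x \<in> set (awalk_verts u p). d x \<le> d u"
      using path[of u u'] h \<open>u \<noteq> u'\<close> by auto
    obtain e where e: "e \<in> arcs G" "tail G e = v" "head G e = u"
      using graph_symmetric[OF h(1)] by auto
    have "v \<notin> set (awalk_verts u p)" using p(3) h(3) by auto
    then have "apath v (e # p) u'" using p(1) e by (simp add: apath_Cons_iff)
    then show False
      using cycle_of_apath[OF _ h(2)] no_cycle[of "_ # e # p"] p(2) by auto
  qed
qed

end

section \<open>Distance levels inside components\<close>

context wf_digraph
begin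

lemma graph_dist_le: "awalk u p v \<Longrightarrow> graph_dist G u v \<le> length p"
  unfolding graph_dist_def by (rule Least_le) blast

lemma graph_dist_awalk:
  assumes "u \<rightarrow>\<^sup>* v"
  obtains p where "awalk u p v" "length p = graph_dist G u v"
proof -
  have "\<exists>n p. awalk u p v \<and> length p = n" using assms by (auto simp: reachable_awalk)
  then have "\<exists>p. awalk u p v \<and> length p = graph_dist G u v"
    unfolding graph_dist_def by (rule LeastI_ex)
  then show ?thesis using that by blast
qed

lemma graph_dist_eq_0: "u \<rightarrow>\<^sup>* v \<Longrightarrow> graph_dist G u v = 0 \<Longrightarrow> u = v"
  by (erule graph_dist_awalk) (simp add: awalk_Nil_iff)

lemma graph_dist_adj_le:
  assumes "a \<rightarrow>\<^sup>* u" "u \<rightarrow> v"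
  shows "graph_dist G a v \<le> Suc (graph_dist G a u)"
proof -
  obtain p where p: "awalk a p u" "length p = graph_dist G a u"
    using graph_dist_awalk[OF assms(1)] .
  obtain e where e: "e \<in> arcs G" "tail G e = u" "head G e = v" using assms(2) by auto
  have "awalk a (p @ [e]) v"
    using p(1) e arc_implies_awalk[OF e(1)] by (intro awalk_appendI) auto
  from graph_dist_le[OF this] show ?thesis using p(2) by simp
qed

text \<open>Remove the last arc of a shortest walk. The remaining prefix bounds the distance of its
  end from above, and re-adding the arc bounds it from below.\<close>

lemma graph_dist_predecessor:
  assumes "a \<rightarrow>\<^sup>* v" "0 < graph_dist G a v"
  shows "\<exists>u. u \<rightarrow> v \<and> graph_dist G a v = Suc (graph_dist G a u)"
proof -
  obtain p where p: "awalk a p v" "length p = graph_dist G a v"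
    using graph_dist_awalk[OF assms(1)] .
  then obtain q e where q: "p = q @ [e]" using assms(2) by (cases p rule: rev_cases) auto
  then have w: "awalk a q (tail G e)" "e \<in> arcs G" "head G e = v"
    using p(1) by (auto simp: awalk_Cons_iff awalk_Nil_iff)
  have adj: "tail G e \<rightarrow> v" using in_arcs_imp_in_arcs_ends[OF w(2)] w(3) by simp
  have "a \<rightarrow>\<^sup>* tail G e" using w(1) by (rule reachable_awalkI)
  then have "graph_dist G a v \<le> Suc (graph_dist G a (tail G e))" using adj by (rule graph_dist_adj_le)
  moreover have "graph_dist G a (tail G e) \<le> length q" using w(1) by (rule graph_dist_le)
  ultimately show ?thesis using adj p(2) q by auto
qed

end

context graph
begin

lemma finite_sccs: "finite sccs"
  unfolding sccs_conv_sccs_verts using finite_sccs_verts by simp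

text \<open>The level is the distance from a central vertex, measured inside the component;
  eccentricity bounds it by the radius of that component and hence by \<open>rad G\<close>.\<close>

lemma radius_levels_exist:
  obtains d :: "'a \<Rightarrow> nat" where
    "\<And>v. v \<in> verts G \<Longrightarrow> d v \<le> rad G"
    "\<And>u v. u \<rightarrow>\<^bsub>G\<^esub> v \<Longrightarrow> d v \<le> Suc (d u)"
    "\<And>v. v \<in> verts G \<Longrightarrow> 0 < d v \<Longrightarrow> \<exists>u. u \<rightarrow>\<^bsub>G\<^esub> v \<and> d v = Suc (d u)"
    "\<And>u v. u \<rightarrow>\<^sup>*\<^bsub>G\<^esub> v \<Longrightarrow> d u = 0 \<Longrightarrow> d v = 0 \<Longrightarrow> u = v"
proof -
  define C where "C v = G \<restriction> scc_of v" for v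
  have C_scc: "C v \<in> sccs" if "v \<in> verts G" for v
    unfolding C_def using that in_verts_sccsD_sccs scc_of_in_sccs_verts by blast
  have C_verts: "verts (C v) = scc_of v" for v by (simp add: C_def)
  have C_fin: "finite (verts (C v))" if "v \<in> verts G" for v
    unfolding C_verts using sccs_verts_subsets[OF scc_of_in_sccs_verts[OF that]] finite_verts
    by (rule finite_subset)
  have C_wf: "wf_digraph (C v)" for v unfolding C_def by (rule wellformed_induce_subgraph) 
  have C_eq: "C u = C v" if "u \<rightarrow>\<^sup>* v" for u v
    unfolding C_def using scc_of_eq[OF scc_ofI_reachable[OF that]] by simp
  have C_adj: "u \<rightarrow>\<^bsub>C v\<^esub> v \<longleftrightarrow> u \<rightarrow>\<^bsub>G\<^esub> v" for u v
  proof
    show "u \<rightarrow>\<^bsub>C v\<^esub> v \<Longrightarrow> u \<rightarrow>\<^bsub>G\<^esub> v"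
      by (auto simp: C_def arcs_ends_conv)
    assume uv: "u \<rightarrow>\<^bsub>G\<^esub> v"
    then have "u \<in> scc_of v" "v \<in> scc_of v"
      using adj_in_verts in_scc_of_self by (auto intro: scc_ofI_reachable)
    then show "u \<rightarrow>\<^bsub>C v\<^esub> v" using uv
      by (auto simp: C_def arcs_ends_conv)
  qed
  \<comment> \<open>The choice depends on the component alone, not on a vertex of it, so mutually
    reachable vertices get the same root.\<close>
  define root where
    "root H = (SOME a. a \<in> verts H \<and> eccentricity H a = connected_radius H)" for H :: "('a,'b) pre_digraph"
  have root: "root (C v) \<in> verts (C v) \<and> eccentricity (C v) (root (C v)) = connected_radius (C v)"
    if v: "v \<in> verts G" for v
  proof -
    have "verts (C v) \<noteq> {}" using in_scc_of_self[OF v] by (auto simp: C_verts)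
    then have "connected_radius (C v) \<in> eccentricity (C v) ` verts (C v)"
      unfolding connected_radius_def using C_fin[OF v] by (intro Min_in) auto
    then have "\<exists>a. a \<in> verts (C v) \<and> eccentricity (C v) a = connected_radius (C v)" by auto
    then show ?thesis unfolding root_def by (rule someI_ex)
  qed
  define d where "d v = graph_dist (C v) (root (C v)) v" for v
  have reach: "root (C v) \<rightarrow>\<^sup>*\<^bsub>C v\<^esub> u" if "v \<in> verts G" "u \<in> verts (C v)" for u v
    using C_scc[OF that(1)] root[OF that(1)] that(2) by (auto simp: sccs_def strongly_connected_def)
  have self: "v \<in> verts (C v)" if "v \<in> verts G" for v
    using in_scc_of_self[OF that] by (simp add: C_verts)
  show thesis
  proof
    fix v assume v: "v \<in> verts G"
    have "d v \<le> eccentricity (C v) (root (C v))"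
      unfolding d_def eccentricity_def using C_fin[OF v] self[OF v] by (intro Max_ge) auto
    also have "\<dots> = connected_radius (C v)" using root[OF v] by simp
    also have "\<dots> \<le> rad G"
      unfolding rad_def using finite_sccs C_scc[OF v] by (intro Max_ge) auto
    finally show "d v \<le> rad G" .
  next
    fix u v assume uv: "u \<rightarrow>\<^bsub>G\<^esub> v"
    then have V: "v \<in> verts G" "u \<in> verts G" using adj_in_verts by auto
    have eq: "C u = C v" using uv by (intro C_eq) auto
    show "d v \<le> Suc (d u)"
      unfolding d_def eq using reach[OF V(1), of u] self[OF V(2)] uv C_adj[of u v] eq
      by (intro wf_digraph.graph_dist_adj_le[OF C_wf]) auto
  next
    fix v assume v: "v \<in> verts G" "0 < d v"
    then obtain u where u: "u \<rightarrow>\<^bsub>C v\<^esub> v" "d v = Suc (graph_dist (C v) (root (C v)) u)"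
      using wf_digraph.graph_dist_predecessor[OF C_wf reach[OF v(1) self[OF v(1)]]]
      unfolding d_def by blast
    then have uv: "u \<rightarrow>\<^bsub>G\<^esub> v" using C_adj by blast
    then have "C u = C v" by (intro C_eq) auto
    then show "\<exists>u. u \<rightarrow>\<^bsub>G\<^esub> v \<and> d v = Suc (d u)"
      using u(2) uv by (auto simp: d_def intro!: exI[of _ u])
  next
    fix u v assume uv: "u \<rightarrow>\<^sup>*\<^bsub>G\<^esub> v" "d u = 0" "d v = 0"
    then have V: "u \<in> verts G" "v \<in> verts G" by (auto simp: reachable_in_verts)
    \<comment> \<open>Distance 0 identifies each vertex with the root of its component, and the two
      components coincide.\<close>
    have "root (C u) = u" "root (C v) = v"
      using uv wf_digraph.graph_dist_eq_0[OF C_wf reach[OF V(1) self[OF V(1)]]]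
        wf_digraph.graph_dist_eq_0[OF C_wf reach[OF V(2) self[OF V(2)]]]
      by (auto simp: d_def)
    then show "u = v" using C_eq[OF uv(1)] by metis
  qed
qed

end

section \<open>From levels to the bound on the star number\<close>

theorem theorem9:
  fixes G :: "('a, 'b) pre_digraph"
  assumes "graph G"
    and "acyclic_graph G"
    and "arcs G \<noteq> {}"
  shows "star_number G \<le> rad G"
proof -
  interpret graph G by fact
  obtain d :: "'a \<Rightarrow> nat" where depth: "\<And>v. v \<in> verts G \<Longrightarrow> d v \<le> rad G"
    and step: "\<And>u v. u \<rightarrow>\<^bsub>G\<^esub> v \<Longrightarrow> d v \<le> Suc (d u)"
    and parent: "\<And>v. v \<in> verts G \<Longrightarrow> 0 < d v \<Longrightarrow> \<exists>u. u \<rightarrow>\<^bsub>G\<^esub> v \<and> d v = Suc (d u)"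
    and root: "\<And>u v. u \<rightarrow>\<^sup>*\<^bsub>G\<^esub> v \<Longrightarrow> d u = 0 \<Longrightarrow> d v = 0 \<Longrightarrow> u = v"
    using radius_levels_exist by blast
  have neq: "d u \<noteq> d v" if "u \<rightarrow>\<^bsub>G\<^esub> v" for u v
    by (rule acyclic_levels_adj_neq[OF assms(2) parent root]) (assumption | rule that)+
  have unique: "u = u'"
    if "u \<rightarrow>\<^bsub>G\<^esub> v" "u' \<rightarrow>\<^bsub>G\<^esub> v" "d v = Suc (d u)" "d v = Suc (d u')" for u u' v
    by (rule acyclic_levels_parent_unique[OF assms(2) parent root]) (assumption | rule that)+
  \<comment> \<open>At level 0 the chosen value is arbitrary, hence the guards
    \<open>0 < d v\<close> wherever parents are used.\<close>
  define par where "par v = (SOME u. u \<rightarrow>\<^bsub>G\<^esub> v \<and> d v = Suc (d u))" for v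
  have par: "par v \<rightarrow>\<^bsub>G\<^esub> v \<and> d v = Suc (d (par v))" if "v \<in> verts G" "0 < d v" for v
    unfolding par_def using parent[OF that] by (rule someI_ex)
  have up: "u = par v" if "u \<rightarrow>\<^bsub>G\<^esub> v" "d v = Suc (d u)" for u v
    using unique[OF that(1) _ that(2)] par[of v] adj_in_verts[OF that(1)] that(2) by simp
  have "is_star_k_PCG (rad G) G"
  proof (rule star_PCG_of_levels)
    show "par v \<in> verts G \<and> d v = Suc (d (par v))" if "v \<in> verts G" "0 < d v" for v
      using par[OF that] adj_in_verts by blast
    show "u \<rightarrow>\<^bsub>G\<^esub> v \<longleftrightarrow> (0 < d v \<and> u = par v) \<or> (0 < d u \<and> v = par u)"
      if uv: "u \<in> verts G" "v \<in> verts G" for u v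
    proof
      assume *: "u \<rightarrow>\<^bsub>G\<^esub> v"
      \<comment> \<open>Distances along an edge change by at most 1 in either direction, and
        acyclicity excludes a change of 0.\<close>
      have "d v = Suc (d u) \<or> d u = Suc (d v)"
        using step[OF *] step[OF graph_symmetric[OF *]] neq[OF *] by linarith
      then show "(0 < d v \<and> u = par v) \<or> (0 < d u \<and> v = par u)"
        using up[OF *] up[OF graph_symmetric[OF *]] by auto
    qed (use par uv graph_symmetric in blast)
  qed (use depth in auto)
  \<comment> \<open>The star number ranges over positive \<open>k\<close> only. The ends of an edge
    lie on different levels, so one of these is positive and bounds the radius from below.\<close>
  moreover have "0 < rad G"
  proof -
    obtain e where e: "e \<in> arcs G" using assms(3) by blast
    then have "tail G e \<rightarrow>\<^bsub>G\<^esub> head G e" by (rule in_arcs_imp_in_arcs_ends)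
    from neq[OF this] have "0 < d (tail G e) \<or> 0 < d (head G e)" by linarith
    then show ?thesis using depth[of "tail G e"] depth[of "head G e"] e by force
  qed
  ultimately show ?thesis unfolding star_number_def by (intro Least_le) simp
qed

end
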